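(* Let $n\ge1$ be an integer. The derivatives of the Zagier polynomials satisfy $$\frac{d}{dx}B_n^{*}(x)=\sum_{j=1}^{\lfloor n/2\rfloor}(2j-1)B_{2j-1}^{*}(x)\quad\text{for } n \text{ even},$$ and $$\frac{d}{dx}B_n^{*}(x)=\frac12+\sum_{j=1}^{\lfloor n/2\rfloor}2j\,B_{2j}^{*}(x)\quad\text{for } n\text{ odd}.$$
   Context: The Bernoulli polynomials $B_r(x)$ are defined by $\frac{te^{xt}}{e^t-1}=\sum_{r=0}^\infty B_r(x)\frac{t^r}{r!}$. For an integer $n>0$ the Zagier polynomial is $B_n^{*}(x)=\sum_{r=0}^{n}\binom{n+r}{2r}\frac{B_r(x)}{n+r}$. Empty sums are $0$. *)

theory Defs
  imports Complex_Main "HOL-Computational_Algebra.Formal_Power_Series"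
begin

text \<open>The generating function t exp(xt) / (exp(t) - 1), as a formal power series in t.
  The denominator has zero constant term; the power series division cancels the common
  factor t, as the lemma below confirms.\<close>

definition bernoulli_gf :: "'a :: field_char_0 \<Rightarrow> 'a fps" where
  "bernoulli_gf x = fps_X * fps_exp x / (fps_exp 1 - 1)"

lemma bernoulli_gf_times: "bernoulli_gf x * (fps_exp 1 - 1) = fps_X * fps_exp x"
proof -
  have "fps_nth (fps_exp 1 - 1 :: 'a fps) 0 = 0" "fps_nth (fps_exp 1 - 1 :: 'a fps) 1 = 1"
    by simp_all
  then have ne: "fps_exp 1 - 1 \<noteq> (0 :: 'a fps)" and sd: "subdegree (fps_exp 1 - 1 :: 'a fps) = 1"
    by (auto intro!: subdegreeI)
  have "fps_exp x \<noteq> (0 :: 'a fps)"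
    by (metis fps_exp_nth fps_zero_nth fact_0 power_0 div_by_1 of_nat_1 zero_neq_one)
  then have "subdegree (fps_X * fps_exp x :: 'a fps) \<ge> 1"
    by simp
  with ne sd have "fps_exp 1 - 1 dvd (fps_X * fps_exp x :: 'a fps)"
    by (subst fps_dvd_iff) auto
  then show ?thesis
    by (simp add: bernoulli_gf_def)
qed

definition bernoulli_poly :: "nat \<Rightarrow> 'a :: field_char_0 \<Rightarrow> 'a" where
  "bernoulli_poly r x = fact r * fps_nth (bernoulli_gf x) r"

text \<open>Only meaningful for n > 0: for n = 0 the summand is a division by zero.\<close>

definition zagier_poly :: "nat \<Rightarrow> 'a :: field_char_0 \<Rightarrow> 'a" where
  "zagier_poly n x =
     (\<Sum>r = 0..n. of_nat ((n + r) choose (2 * r)) * bernoulli_poly r x / of_nat (n + r))"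

end

theory Submission
  imports Defs
begin

text \<open>
  The Bernoulli polynomials form an Appell sequence, so that differentiating a Zagier polynomial
  only shifts the indices of its Bernoulli polynomials. Comparing coefficients, Pascal's rule
  gives the derivative of B*(n+2) - B*(n) as (n+1) B*(n+1), and the formulas follow by
  telescoping in steps of two from n = 0 and n = 1.
\<close>

text \<open>Confines the dependence on \<open>x\<close> to an exponential factor, by cancelling the
  nonzero series \<open>fps_exp 1 - 1\<close>.\<close>

lemma bernoulli_gf_eq_exp_times: "bernoulli_gf x = fps_exp x * bernoulli_gf 0"
proof -
  have "bernoulli_gf x * (fps_exp 1 - 1) = (fps_exp x * bernoulli_gf 0) * (fps_exp 1 - 1)"
    by (simp add: bernoulli_gf_times mult.assoc mult.commute)
  moreover have "fps_exp 1 - 1 \<noteq> (0 :: 'a fps)"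
  proof
    assume "fps_exp 1 - 1 = (0 :: 'a fps)"
    then have "fps_nth (fps_exp 1 - 1 :: 'a fps) 1 = 0" by simp
    then show False by simp
  qed
  ultimately show ?thesis by simp
qed

text \<open>Each coefficient is a Cauchy product of the series of \<open>fps_exp x\<close> with one
  free of \<open>x\<close>, hence a polynomial in \<open>x\<close> that can be differentiated
  termwise.\<close>

lemma bernoulli_gf_nth_has_field_derivative:
  "((\<lambda>x :: 'a :: real_normed_field. fps_nth (bernoulli_gf x) (Suc r)) has_field_derivative
     fps_nth (bernoulli_gf x) r) (at x)"
proof -
  define g where "g = fps_nth (bernoulli_gf (0 :: 'a))"
  have nth: "fps_nth (bernoulli_gf y) k = (\<Sum>i=0..k. y ^ i / fact i * g (k - i))" for y :: 'a and k
    by (subst bernoulli_gf_eq_exp_times) (simp add: fps_mult_nth g_def)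
  \<comment> \<open>The term at \<open>i = 0\<close> vanishes through its factor
    \<open>of_nat i\<close>, so the truncated exponent \<open>i - 1\<close> does no harm; the rest
    is reindexed by one.\<close>
  have shift: "(\<Sum>i=0..Suc r. of_nat i * x ^ (i - 1) / fact i * g (Suc r - i))
      = fps_nth (bernoulli_gf x) r"
    unfolding nth sum.atLeast0_atMost_Suc_shift by (simp add: divide_simps del: of_nat_Suc)
  show ?thesis
    unfolding nth [of _ "Suc r"] shift [symmetric]
    by (auto intro!: derivative_eq_intros sum.cong simp del: sum.cl_ivl_Suc)
qed

lemma bernoulli_poly_0: "bernoulli_poly 0 x = (1 :: 'a :: field_char_0)"
proof -
  have "fps_nth (bernoulli_gf x * (fps_exp 1 - 1)) 1 = fps_nth (fps_X * fps_exp x) 1"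
    by (simp only: bernoulli_gf_times)
  then show ?thesis by (simp add: bernoulli_poly_def fps_mult_nth)
qed

lemma bernoulli_poly_Suc_has_field_derivative:
  "(bernoulli_poly (Suc r) has_field_derivative of_nat (Suc r) * bernoulli_poly r x)
     (at (x :: 'a :: real_normed_field))"
proof -
  have "((\<lambda>y. fact (Suc r) * fps_nth (bernoulli_gf y) (Suc r)) has_field_derivative
      fact (Suc r) * fps_nth (bernoulli_gf x) r) (at x)"
    by (intro DERIV_cmult bernoulli_gf_nth_has_field_derivative)
  then show ?thesis
    by (simp add: bernoulli_poly_def [abs_def] mult.assoc)
qed

text \<open>Zero for r > n, since then 2r > n + r: sums for different \<open>n\<close> can thus
  share one range. It is also zero at n = r = 0, by division by zero.\<close>

definition zagier_coeff :: "nat \<Rightarrow> nat \<Rightarrow> 'a :: field_char_0" where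
  "zagier_coeff n r = of_nat ((n + r) choose (2 * r)) / of_nat (n + r)"

lemma zagier_poly_eq_sum_coeff:
  assumes "n \<le> N"
  shows "zagier_poly n x = (\<Sum>r=0..N. zagier_coeff n r * bernoulli_poly r x)"
  unfolding zagier_poly_def
  by (rule sum.mono_neutral_cong_left) (use assms in \<open>auto simp: zagier_coeff_def\<close>)

text \<open>Absorption, (2r+2) C(n+r+1, 2r+2) = (n+r+1) C(n+r, 2r+1), cancels the denominator
  n+r+1.\<close>

lemma Suc_times_zagier_coeff_Suc:
  "of_nat (Suc r) * zagier_coeff n (Suc r)
     = (of_nat ((n + r) choose (2 * r + 1)) / 2 :: 'a :: field_char_0)"
proof -
  have "Suc (2 * r + 1) * (Suc (n + r) choose Suc (2 * r + 1))
      = Suc (n + r) * ((n + r) choose (2 * r + 1))"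
    by (rule Suc_times_binomial)
  then have "of_nat (Suc (2 * r + 1)) * of_nat (Suc (n + r) choose Suc (2 * r + 1))
      = (of_nat (Suc (n + r)) * of_nat ((n + r) choose (2 * r + 1)) :: 'a)"
    by (metis of_nat_mult)
  moreover have "of_nat (Suc (n + r)) \<noteq> (0 :: 'a)"
    by (simp del: of_nat_Suc)
  ultimately show ?thesis
    by (simp add: zagier_coeff_def field_simps del: binomial_Suc_Suc)
qed

text \<open>By the previous lemma and Pascal's rule applied twice, the two half-binomials differ by
  (a + b)/2. Absorption gives (n+r+1) b = (n+1-r) a, hence (n+r+1)(a + b) = 2(n+1) a.\<close>

lemma zagier_coeff_recurrence:
  "of_nat (Suc r) * zagier_coeff (n + 2) (Suc r)
     = of_nat (Suc r) * zagier_coeff n (Suc r)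
       + (of_nat (n + 1) * zagier_coeff (n + 1) r :: 'a :: field_char_0)"
proof -
  define a b where "a = (Suc (n + r) choose (2 * r))" and "b = ((n + r) choose (2 * r))"
  have pascal: "((n + 2 + r) choose (2 * r + 1)) = a + b + ((n + r) choose (2 * r + 1))"
    by (simp add: a_def b_def)
  have "of_nat (Suc (n + r)) * of_nat b = (of_nat (Suc (n + r)) - of_nat (2 * r)) * (of_nat a :: 'a)"
  \<comment> \<open>Absorption on naturals has a truncated difference, which is exact only in the
    first case; in the other both binomials are zero.\<close>
  proof (cases "2 * r \<le> Suc (n + r)")
    case True
    have "Suc (n + r) * b = (Suc (n + r) - 2 * r) * a"
      using binomial_absorb_comp [of "Suc (n + r)" "2 * r"] by (simp add: a_def b_def)
    then have "of_nat (Suc (n + r)) * of_nat b = (of_nat (Suc (n + r) - 2 * r) * of_nat a :: 'a)"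
      by (metis of_nat_mult)
    with True show ?thesis by (simp only: of_nat_diff)
  next
    case False
    then have "a = 0" "b = 0"
      unfolding a_def b_def by (intro binomial_eq_0; simp)+
    then show ?thesis by simp
  qed
  then have "of_nat (Suc (n + r)) * (of_nat a + of_nat b) = (2 * of_nat (n + 1) * of_nat a :: 'a)"
    by (simp add: algebra_simps)
  moreover have "of_nat (Suc (n + r)) \<noteq> (0 :: 'a)"
    by (simp del: of_nat_Suc)
  ultimately have "(of_nat a + of_nat b) / 2 = (of_nat (n + 1) * of_nat a / of_nat (Suc (n + r)) :: 'a)"
    by (simp add: field_simps del: of_nat_Suc)
  moreover have "zagier_coeff (n + 1) r = (of_nat a / of_nat (Suc (n + r)) :: 'a)"
    by (simp add: zagier_coeff_def a_def)
  ultimately show ?thesis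
    unfolding Suc_times_zagier_coeff_Suc pascal by (simp add: add_divide_distrib)
qed

text \<open>The termwise derivative, reindexed by one. Its top term r = n has coefficient zero, so
  the range needs no \<open>n - 1\<close>.\<close>

definition zagier_poly_deriv :: "nat \<Rightarrow> 'a :: field_char_0 \<Rightarrow> 'a" where
  "zagier_poly_deriv n x = (\<Sum>r=0..n. of_nat (Suc r) * zagier_coeff n (Suc r) * bernoulli_poly r x)"

lemma zagier_poly_deriv_eq_sum:
  assumes "n \<le> N"
  shows "zagier_poly_deriv n x
     = (\<Sum>r=0..N. of_nat (Suc r) * zagier_coeff n (Suc r) * bernoulli_poly r x)"
  unfolding zagier_poly_deriv_def
  by (rule sum.mono_neutral_cong_left)
    (use assms in \<open>auto simp: zagier_coeff_def simp del: binomial_Suc_Suc\<close>)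

lemma zagier_poly_has_field_derivative:
  "(zagier_poly n has_field_derivative zagier_poly_deriv n x) (at (x :: 'a :: real_normed_field))"
proof -
  \<comment> \<open>Extending the sum to \<open>Suc n\<close> and splitting off the constant term
    makes the remaining range match \<open>zagier_poly_deriv\<close>.\<close>
  have eq: "zagier_poly n = (\<lambda>y :: 'a. zagier_coeff n 0
      + (\<Sum>r=0..n. zagier_coeff n (Suc r) * bernoulli_poly (Suc r) y))"
    by (rule ext, subst zagier_poly_eq_sum_coeff [of n "Suc n"])
      (simp_all add: sum.atLeast0_atMost_Suc_shift bernoulli_poly_0 del: sum.cl_ivl_Suc)
  show ?thesis
    unfolding eq zagier_poly_deriv_def
    by (auto intro!: derivative_eq_intros bernoulli_poly_Suc_has_field_derivative sum.cong
        simp: mult_ac simp del: of_nat_Suc)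
qed

text \<open>Over the common range up to \<open>n + 2\<close>, this is
  \<open>zagier_coeff_recurrence\<close> term by term.\<close>

lemma zagier_poly_deriv_Suc_Suc:
  "zagier_poly_deriv (n + 2) x = zagier_poly_deriv n x + of_nat (n + 1) * zagier_poly (n + 1) x"
  by (simp add: zagier_poly_deriv_eq_sum [of n "n + 2"] zagier_poly_deriv_eq_sum [of "n + 2" "n + 2"]
      zagier_poly_eq_sum_coeff [of "n + 1" "n + 2"] zagier_coeff_recurrence distrib_right
      sum.distrib sum_distrib_left mult.assoc
      del: sum.cl_ivl_Suc of_nat_Suc of_nat_add add_2_eq_Suc add_2_eq_Suc' One_nat_def)

lemma zagier_poly_deriv_even:
  "zagier_poly_deriv (2 * m) x = (\<Sum>j=1..m. of_nat (2 * j - 1) * zagier_poly (2 * j - 1) x)"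
proof (induction m)
  case 0
  show ?case by (simp add: zagier_poly_deriv_def zagier_coeff_def)
next
  case (Suc m)
  then show ?case using zagier_poly_deriv_Suc_Suc [of "2 * m" x] by simp
qed

lemma zagier_poly_deriv_odd:
  "zagier_poly_deriv (2 * m + 1) x = 1 / 2 + (\<Sum>j=1..m. of_nat (2 * j) * zagier_poly (2 * j) x)"
proof (induction m)
  case 0
  \<comment> \<open>The constant 1/2 arises here: for n = 1 only r = 0 contributes, with C(2,
    2)/2.\<close>
  show ?case by (simp add: zagier_poly_deriv_def zagier_coeff_def bernoulli_poly_0 binomial_eq_0)
next
  case (Suc m)
  then show ?case using zagier_poly_deriv_Suc_Suc [of "2 * m + 1" x] by (simp add: add_ac)
qed

theorem theorem8p2:
  fixes x :: "'a :: real_normed_field" and n :: nat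
  assumes "n \<ge> 1"
  shows "(even n \<longrightarrow>
           (zagier_poly n has_field_derivative
             (\<Sum>j = 1..n div 2. of_nat (2 * j - 1) * zagier_poly (2 * j - 1) x)) (at x)) \<and>
         (odd n \<longrightarrow>
           (zagier_poly n has_field_derivative
             (1 / 2 + (\<Sum>j = 1..n div 2. of_nat (2 * j) * zagier_poly (2 * j) x))) (at x))"
  using zagier_poly_has_field_derivative [of n x]
    zagier_poly_deriv_even [of "n div 2" x] zagier_poly_deriv_odd [of "n div 2" x]
  by (metis dvd_mult_div_cancel odd_two_times_div_two_succ)

end
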